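(* Let $G$ be a finite group which is the internal central product $G = U_1U_2$ of subgroups $U_1, U_2 \leq G$. Let $D = U_1\times U_2$ be the external direct product, let $\overline{U}_1=\{(u_1,1) : u_1\in U_1\}$ and $\overline{U}_2=\{(1,u_2) : u_2\in U_2\}$, and let $\varepsilon : D \to G$ be an epimorphism with $\varepsilon(\overline{U}_i)=U_i$ for $i=1,2$. Let $H \leq G$ and let $r\geq 1$ be an integer. Then the following are equivalent: (1) $H$ is subnormal in $G$ of defect less than or equal to $r$. (2) $\varepsilon^{-1}(H)$ is subnormal in $D$ of defect less than or equal to $r$. (3) $[\overline{U}_i,\underbrace{\varepsilon^{-1}(H),\ldots,\varepsilon^{-1}(H)}_{r}]\leq \overline{U}_i\cap \varepsilon^{-1}(H)$ for $i=1,2$. (4) $[U_i,\underbrace{H,\ldots,H}_{r}]\leq U_i\cap H$ for $i=1,2$.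
   Context: $G$ is an internal central product of subgroups $U_1,U_2\leq G$ if $G=U_1U_2$ and $[U_1,U_2]=1$. A subgroup $H\leq G$ is subnormal in $G$ if there is a chain $H=H_0\unlhd H_1\unlhd\cdots\unlhd H_r=G$; its defect is the minimal possible length $r$ of such a chain. For elements, $[a,b]=a^{-1}b^{-1}ab$; for subgroups $A,B$, $[A,B]$ denotes the subgroup generated by all $[a,b]$ with $a\in A$, $b\in B$; multi-fold commutators are left-normed: $[A_1,\ldots,A_n]=[[A_1,\ldots,A_{n-1}],A_n]$. $\varepsilon^{-1}(H)$ is the full preimage of $H$. *)

theory Defs
  imports "HOL-Algebra.Generated_Groups"
begin

(* The convention [a,b] = a^-1 b^-1 a b differs from the one used in derived_set
   (a b a^-1 b^-1). *)
definition commutator :: "('a, 'b) monoid_scheme \<Rightarrow> 'a \<Rightarrow> 'a \<Rightarrow> 'a" where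
  "commutator G a b = inv\<^bsub>G\<^esub> a \<otimes>\<^bsub>G\<^esub> inv\<^bsub>G\<^esub> b \<otimes>\<^bsub>G\<^esub> a \<otimes>\<^bsub>G\<^esub> b"

definition commutator_subgroup :: "('a, 'b) monoid_scheme \<Rightarrow> 'a set \<Rightarrow> 'a set \<Rightarrow> 'a set" where
  "commutator_subgroup G A B = generate G {commutator G a b | a b. a \<in> A \<and> b \<in> B}"

(* multi_commutator G A [B1, ..., Bn] is the left-normed [A, B1, ..., Bn]. *)
definition multi_commutator :: "('a, 'b) monoid_scheme \<Rightarrow> 'a set \<Rightarrow> 'a set list \<Rightarrow> 'a set" where
  "multi_commutator G A Bs = foldl (commutator_subgroup G) A Bs"

definition internal_central_product ::
    "('a, 'b) monoid_scheme \<Rightarrow> 'a set \<Rightarrow> 'a set \<Rightarrow> bool" where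
  "internal_central_product G U\<^sub>1 U\<^sub>2 \<longleftrightarrow>
     subgroup U\<^sub>1 G \<and> subgroup U\<^sub>2 G \<and>
     carrier G = U\<^sub>1 <#>\<^bsub>G\<^esub> U\<^sub>2 \<and> commutator_subgroup G U\<^sub>1 U\<^sub>2 = {\<one>\<^bsub>G\<^esub>}"

(* A chain K 0, ..., K r of length r from H to G; the values K i for i > r are irrelevant. *)
definition subnormal_chain ::
    "('a, 'b) monoid_scheme \<Rightarrow> 'a set \<Rightarrow> nat \<Rightarrow> (nat \<Rightarrow> 'a set) \<Rightarrow> bool" where
  "subnormal_chain G H r K \<longleftrightarrow>
     K 0 = H \<and> K r = carrier G \<and>
     (\<forall>i\<le>r. subgroup (K i) G) \<and>
     (\<forall>i<r. K i \<lhd> G\<lparr>carrier := K (Suc i)\<rparr>)"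

definition subnormal :: "('a, 'b) monoid_scheme \<Rightarrow> 'a set \<Rightarrow> bool" where
  "subnormal G H \<longleftrightarrow> (\<exists>r K. subnormal_chain G H r K)"

(* Only meaningful when H is subnormal in G. *)
definition defect :: "('a, 'b) monoid_scheme \<Rightarrow> 'a set \<Rightarrow> nat" where
  "defect G H = (LEAST r. \<exists>K. subnormal_chain G H r K)"

end

theory Submission
  imports Defs
begin

text \<open>
  A subgroup \<open>H\<close> is subnormal of defect at most \<open>r\<close> iff \<open>[G, H, \<dots>, H] \<le> H\<close> with \<open>r\<close> copies of
  \<open>H\<close>: writing \<open>L i\<close> for the \<open>i\<close>-fold commutator, a subnormal chain from above satisfies
  \<open>L i \<le> K (r - i)\<close>, and conversely the groups \<open>H L i\<close> form a chain. In a central product \<open>U\<^sub>1 U\<^sub>2\<close> the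
  identity \<open>[u v, h] = [u, h] [v, h]\<close> gives \<open>[G, H, \<dots>, H] \<le> [U\<^sub>1, H, \<dots>, H] [U\<^sub>2, H, \<dots>, H]\<close>, so the
  condition can be tested on the two factors. This applies to \<open>G\<close> and, as \<open>D\<close> is the central product of
  the embedded factors, to \<open>D\<close>; and \<open>\<epsilon>\<close> maps \<open>[D, E, \<dots>, E]\<close> onto \<open>[G, H, \<dots>, H]\<close>.
\<close>

section \<open>Commutator subgroups\<close>

context group
begin

text \<open>Together with \<open>m_assoc\<close> and \<open>inv_mult_group\<close> these rules
  reduce right-associated group words, so simp can check the commutator identities below.\<close>

lemma cancel_inv_left [simp]:
  assumes "x \<in> carrier G" "y \<in> carrier G"
  shows "x \<otimes> (inv x \<otimes> y) = y" and "inv x \<otimes> (x \<otimes> y) = y"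
  using assms by (simp_all flip: m_assoc)

lemma commutator_closed [simp]:
  "a \<in> carrier G \<Longrightarrow> b \<in> carrier G \<Longrightarrow> commutator G a b \<in> carrier G"
  by (simp add: commutator_def)

lemma commutator_eq_one_iff:
  assumes "a \<in> carrier G" "b \<in> carrier G"
  shows "commutator G a b = \<one> \<longleftrightarrow> a \<otimes> b = b \<otimes> a"
proof -
  have "commutator G a b = inv (b \<otimes> a) \<otimes> (a \<otimes> b)"
    using assms by (simp add: commutator_def m_assoc inv_mult_group)
  also have "\<dots> = \<one> \<longleftrightarrow> a \<otimes> b = b \<otimes> a"
    using assms inv_solve_left'[of \<one> "b \<otimes> a" "a \<otimes> b"] by auto
  finally show ?thesis .
qed

lemma commutator_set_in_carrier:
  "A \<subseteq> carrier G \<Longrightarrow> B \<subseteq> carrier G \<Longrightarrow>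
    {commutator G a b | a b. a \<in> A \<and> b \<in> B} \<subseteq> carrier G"
  by (auto simp: subset_eq)

lemma commutator_subgroup_is_subgroup:
  "A \<subseteq> carrier G \<Longrightarrow> B \<subseteq> carrier G \<Longrightarrow> subgroup (commutator_subgroup G A B) G"
  unfolding commutator_subgroup_def
  by (intro generate_is_subgroup commutator_set_in_carrier)

lemma commutator_in_commutator_subgroup:
  "a \<in> A \<Longrightarrow> b \<in> B \<Longrightarrow> commutator G a b \<in> commutator_subgroup G A B"
  unfolding commutator_subgroup_def by (rule generate.incl) auto

lemma commutator_subgroup_least:
  assumes "subgroup K G" "\<And>a b. a \<in> A \<Longrightarrow> b \<in> B \<Longrightarrow> commutator G a b \<in> K"
  shows "commutator_subgroup G A B \<subseteq> K"
  unfolding commutator_subgroup_def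
  by (rule generate_subgroup_incl) (use assms in auto)

lemma commutator_subgroup_mono:
  "A \<subseteq> A' \<Longrightarrow> B \<subseteq> B' \<Longrightarrow> commutator_subgroup G A B \<subseteq> commutator_subgroup G A' B'"
  unfolding commutator_subgroup_def by (rule mono_generate) blast

lemma commutator_in_subgroup:
  assumes "subgroup H G" "a \<in> H" "b \<in> H"
  shows "commutator G a b \<in> H"
  using assms unfolding commutator_def
  by (simp add: subgroup.m_closed subgroup.m_inv_closed)

lemma commutator_in_normal:
  assumes "N \<lhd> G" "a \<in> N" "b \<in> carrier G"
  shows "commutator G a b \<in> N"
proof -
  interpret N: normal N G by fact
  have "inv a \<otimes> (inv b \<otimes> a \<otimes> b) \<in> N"
    using assms by (intro N.m_closed N.m_inv_closed N.inv_op_closed1)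
  then show ?thesis
    using assms N.mem_carrier by (simp add: commutator_def m_assoc)
qed

text \<open>Conjugation by \<open>x\<close> is a homomorphism, so the elements that it sends into
  \<open>K\<close> form a subgroup; testing generators suffices.\<close>

lemma conj_in_subgroup_generate:
  assumes "x \<in> carrier G" "S \<subseteq> carrier G" "subgroup K G"
    and "\<And>s. s \<in> S \<Longrightarrow> x \<otimes> s \<otimes> inv x \<in> K"
    and "y \<in> generate G S"
  shows "x \<otimes> y \<otimes> inv x \<in> K"
  using assms(5)
proof induction
  case one
  then show ?case using assms by (simp add: subgroup.one_closed)
next
  case (incl h)
  then show ?case using assms by blast
next
  case (inv h)
  then have "inv (x \<otimes> h \<otimes> inv x) \<in> K" "h \<in> carrier G"
    using assms by (auto intro: subgroup.m_inv_closed)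
  then show ?case using assms by (simp add: inv_mult_group m_assoc)
next
  case (eng h k)
  then have "x \<otimes> h \<otimes> inv x \<otimes> (x \<otimes> k \<otimes> inv x) \<in> K" "h \<in> carrier G" "k \<in> carrier G"
    using assms generate_in_carrier[OF assms(2)] by (auto intro: subgroup.m_closed)
  then show ?case using assms by (simp add: m_assoc)
qed

text \<open>Solving [a x^-1, b] = (x [a,b] x^-1) [x^-1, b] for the conjugate expresses it through
  commutators whose left entries stay in the subgroup \<open>A\<close>. Hence \<open>A\<close>
  normalizes [A,B].\<close>

lemma commutator_subgroup_conj_left:
  assumes "subgroup A G" "B \<subseteq> carrier G" "x \<in> A" "y \<in> commutator_subgroup G A B"
  shows "x \<otimes> y \<otimes> inv x \<in> commutator_subgroup G A B"
proof -
  interpret A: subgroup A G by fact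
  interpret C: subgroup "commutator_subgroup G A B" G
    by (rule commutator_subgroup_is_subgroup[OF A.subset assms(2)])
  have "x \<otimes> commutator G a b \<otimes> inv x \<in> commutator_subgroup G A B" if "a \<in> A" "b \<in> B" for a b
  proof -
    have "x \<otimes> commutator G a b \<otimes> inv x
        = commutator G (a \<otimes> inv x) b \<otimes> inv (commutator G (inv x) b)"
      using that assms(2,3) A.mem_carrier
      by (simp add: commutator_def inv_mult_group m_assoc subset_eq)
    also have "\<dots> \<in> commutator_subgroup G A B"
      using that assms(3)
      by (intro C.m_closed C.m_inv_closed commutator_in_commutator_subgroup A.m_closed A.m_inv_closed)
    finally show ?thesis .
  qed
  then have gen: "x \<otimes> s \<otimes> inv x \<in> commutator_subgroup G A B"
    if "s \<in> {commutator G a b | a b. a \<in> A \<and> b \<in> B}" for s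
    using that by blast
  have "y \<in> generate G {commutator G a b | a b. a \<in> A \<and> b \<in> B}"
    using assms(4) by (simp only: commutator_subgroup_def)
  with gen show ?thesis
    by (rule conj_in_subgroup_generate[OF A.mem_carrier[OF assms(3)]
          commutator_set_in_carrier[OF A.subset assms(2)] C.subgroup_axioms])
qed

text \<open>The mirror identity [a, b x^-1] = [a, x^-1] (x [a,b] x^-1) does the same for the right
  entry, so \<open>B\<close> normalizes [A,B].\<close>

lemma commutator_subgroup_conj_right:
  assumes "A \<subseteq> carrier G" "subgroup B G" "x \<in> B" "y \<in> commutator_subgroup G A B"
  shows "x \<otimes> y \<otimes> inv x \<in> commutator_subgroup G A B"
proof -
  interpret B: subgroup B G by fact
  interpret C: subgroup "commutator_subgroup G A B" G
    by (rule commutator_subgroup_is_subgroup[OF assms(1) B.subset])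
  have "x \<otimes> commutator G a b \<otimes> inv x \<in> commutator_subgroup G A B" if "a \<in> A" "b \<in> B" for a b
  proof -
    have "x \<otimes> commutator G a b \<otimes> inv x
        = inv (commutator G a (inv x)) \<otimes> commutator G a (b \<otimes> inv x)"
      using that assms(1,3) B.mem_carrier
      by (simp add: commutator_def inv_mult_group m_assoc subset_eq)
    also have "\<dots> \<in> commutator_subgroup G A B"
      using that assms(3)
      by (intro C.m_closed C.m_inv_closed commutator_in_commutator_subgroup B.m_closed B.m_inv_closed)
    finally show ?thesis .
  qed
  then have gen: "x \<otimes> s \<otimes> inv x \<in> commutator_subgroup G A B"
    if "s \<in> {commutator G a b | a b. a \<in> A \<and> b \<in> B}" for s
    using that by blast
  have "y \<in> generate G {commutator G a b | a b. a \<in> A \<and> b \<in> B}"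
    using assms(4) by (simp only: commutator_subgroup_def)
  with gen show ?thesis
    by (rule conj_in_subgroup_generate[OF B.mem_carrier[OF assms(3)]
          commutator_set_in_carrier[OF assms(1) B.subset] C.subgroup_axioms])
qed

end

section \<open>Left-normed commutators with a repeated entry\<close>

lemma multi_commutator_Nil [simp]: "multi_commutator G A [] = A"
  by (simp add: multi_commutator_def)

text \<open>\<open>replicate\<close> grows at the front of the list, but the outermost commutator
  uses its last entry. Since all entries are equal, the new one may be moved to the end.\<close>

lemma multi_commutator_Suc:
  "multi_commutator G A (replicate (Suc n) H)
    = commutator_subgroup G (multi_commutator G A (replicate n H)) H"
  by (simp add: multi_commutator_def flip: replicate_append_same)

lemma (in group) multi_commutator_is_subgroup:
  assumes "subgroup A G" "H \<subseteq> carrier G"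
  shows "subgroup (multi_commutator G A (replicate n H)) G"
  by (induction n)
    (simp_all only: multi_commutator_Nil replicate_0 multi_commutator_Suc assms
      commutator_subgroup_is_subgroup subgroup.subset)

lemma (in group) multi_commutator_mono:
  "A \<subseteq> A' \<Longrightarrow> multi_commutator G A (replicate n H) \<subseteq> multi_commutator G A' (replicate n H)"
  by (induction n) (simp_all only: multi_commutator_Nil replicate_0 multi_commutator_Suc
      commutator_subgroup_mono order_refl)

lemma (in group) multi_commutator_normal_subset:
  assumes "N \<lhd> G" "H \<subseteq> carrier G"
  shows "multi_commutator G N (replicate n H) \<subseteq> N"
proof (induction n)
  case (Suc n)
  then show ?case
    unfolding multi_commutator_Suc
    using assms by (intro commutator_subgroup_least)
      (auto intro: commutator_in_normal normal_imp_subgroup)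
qed simp

section \<open>Subnormality through iterated commutators\<close>

context group
begin

text \<open>Normality is tested on generators of both groups. Closure of \<open>T\<close> under
  inverses makes the inverse of a generator again an element of \<open>T\<close>, and for products
  the conjugations are composed.\<close>

lemma normal_generate_generate:
  assumes "T \<subseteq> carrier G" "generate G S \<subseteq> generate G T" "S \<subseteq> carrier G"
    and inv_T: "\<And>t. t \<in> T \<Longrightarrow> inv t \<in> T"
    and conj: "\<And>t s. t \<in> T \<Longrightarrow> s \<in> S \<Longrightarrow> t \<otimes> s \<otimes> inv t \<in> generate G S"
  shows "generate G S \<lhd> G\<lparr>carrier := generate G T\<rparr>"
proof -
  have sT: "subgroup (generate G T) G" and sS: "subgroup (generate G S) G"
    using assms by (auto intro: generate_is_subgroup)
  interpret GT: group "G\<lparr>carrier := generate G T\<rparr>"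
    by (rule subgroup.subgroup_is_group[OF sT group_axioms])
  have *: "x \<otimes> y \<otimes> inv x \<in> generate G S" if "x \<in> generate G T" "y \<in> generate G S" for x y
    using that
  proof (induction arbitrary: y)
    case one
    then show ?case using sS by (simp add: subgroup.mem_carrier)
  next
    case (incl t)
    then show ?case
      using assms sS conj_in_subgroup_generate[of t S "generate G S" y] by blast
  next
    case (inv t)
    then show ?case
      using assms sS conj_in_subgroup_generate[of "inv t" S "generate G S" y] by blast
  next
    case (eng h k)
    then have "h \<otimes> (k \<otimes> y \<otimes> inv k) \<otimes> inv h \<in> generate G S" by blast
    moreover have "h \<in> carrier G" "k \<in> carrier G" "y \<in> carrier G"
      using eng sT sS by (auto dest: subgroup.mem_carrier)
    ultimately show ?case by (simp add: m_assoc inv_mult_group)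
  qed
  show ?thesis
  proof (rule GT.normal_invI)
    show "subgroup (generate G S) (G\<lparr>carrier := generate G T\<rparr>)"
      by (rule subgroup_incl[OF sS sT assms(2)])
    fix x y assume "x \<in> carrier (G\<lparr>carrier := generate G T\<rparr>)" "y \<in> generate G S"
    then show "x \<otimes>\<^bsub>G\<lparr>carrier := generate G T\<rparr>\<^esub> y
        \<otimes>\<^bsub>G\<lparr>carrier := generate G T\<rparr>\<^esub> inv\<^bsub>G\<lparr>carrier := generate G T\<rparr>\<^esub> x \<in> generate G S"
      using * sT by (simp add: m_inv_consistent)
  qed
qed

text \<open>Each commutator with \<open>H\<close> descends one step of the chain: \<open>H\<close>
  lies in every \<open>K j\<close>, and [K (j+1), K j] is contained in \<open>K j\<close> by
  normality.\<close>

lemma multi_commutator_subset_of_chain: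
  assumes K: "subnormal_chain G H r K" and "i \<le> r"
  shows "multi_commutator G (carrier G) (replicate i H) \<subseteq> K (r - i)"
proof -
  have step: "K j \<lhd> G\<lparr>carrier := K (Suc j)\<rparr>" if "j < r" for j
    using K that by (simp add: subnormal_chain_def)
  have sub: "subgroup (K j) G" if "j \<le> r" for j
    using K that by (simp add: subnormal_chain_def)
  have mono: "K j \<subseteq> K (Suc j)" if "j < r" for j
    using normal_imp_subgroup[OF step[OF that]] subgroup.subset by fastforce
  have H: "H \<subseteq> K j" if "j \<le> r" for j
    using that
  proof (induction j)
    case 0
    then show ?case using K by (simp add: subnormal_chain_def)
  next
    case (Suc j)
    then show ?case using mono[of j] by fastforce
  qed
  show "multi_commutator G (carrier G) (replicate i H) \<subseteq> K (r - i)"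
    using \<open>i \<le> r\<close>
  proof (induction i)
    case 0
    then show ?case using K by (simp add: subnormal_chain_def)
  next
    case (Suc i)
    define j where "j = r - Suc i"
    have j: "r - i = Suc j" "j < r"
      using Suc.prems by (auto simp: j_def)
    interpret N: normal "K j" "G\<lparr>carrier := K (Suc j)\<rparr>" by (rule step[OF j(2)])
    have "commutator G a b \<in> K j"
      if "a \<in> multi_commutator G (carrier G) (replicate i H)" "b \<in> H" for a b
    proof -
      have a: "a \<in> K (Suc j)" using Suc that j by auto
      have b: "b \<in> K j" using H[of j] that j by auto
      have sa: "subgroup (K (Suc j)) G" and sb: "subgroup (K j) G"
        using sub j by auto
      \<comment> \<open>[a,b] is the product of this conjugate of b^-1, which is in
        \<open>K j\<close> by normality, and \<open>b\<close> itself.\<close>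
      have "inv a \<otimes> inv b \<otimes> a \<in> K j"
        using N.inv_op_closed1[of a "inv b"] a b sa
        by (simp add: m_inv_consistent subgroup.m_inv_closed[OF sb])
      then show ?thesis
        using b sb by (simp add: commutator_def subgroup.m_closed)
    qed
    then show ?case
      unfolding multi_commutator_Suc j_def[symmetric]
      using sub[of j] j by (intro commutator_subgroup_least) auto
  qed
qed

lemma generate_eq_self: "subgroup H G \<Longrightarrow> generate G H = H"
  by (rule generateI[symmetric]) auto

text \<open>With L_i the i-fold commutator, the chain consists of the groups generated by
  \<open>H\<close> and L_i. Both \<open>H\<close> and L_i normalize L_(i+1) = [L_i, H], and L_i
  centralizes \<open>H\<close> modulo L_(i+1), which gives normality of each group in the next
  larger one.\<close>

lemma subnormal_chain_of_multi_commutator: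
  assumes H: "subgroup H G" and le: "multi_commutator G (carrier G) (replicate r H) \<subseteq> H"
  shows "\<exists>K. subnormal_chain G H r K"
proof -
  interpret H: subgroup H G by fact
  define L where "L i = multi_commutator G (carrier G) (replicate i H)" for i
  have L_Suc: "L (Suc i) = commutator_subgroup G (L i) H" for i
    by (simp only: L_def multi_commutator_Suc)
  have L_subgroup: "subgroup (L i) G" for i
    unfolding L_def by (intro multi_commutator_is_subgroup subgroup_self H.subset)
  have L_carrier: "L i \<subseteq> carrier G" for i
    by (rule subgroup.subset[OF L_subgroup])
  \<comment> \<open>\<open>H\<close> normalizes every L_i: L_0 is the whole group, and each later
    L_i is a commutator subgroup with right entry \<open>H\<close>.\<close>
  have L_conj: "h \<otimes> l \<otimes> inv h \<in> L i" if "h \<in> H" "l \<in> L i" for h l i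
  proof (cases i)
    case 0
    then show ?thesis using that by (simp add: L_def)
  next
    case (Suc j)
    then show ?thesis
      using that H commutator_subgroup_conj_right[OF L_carrier] by (simp add: L_Suc)
  qed
  have L_decr: "L (Suc i) \<subseteq> L i" for i
    unfolding L_Suc
  proof (rule commutator_subgroup_least[OF L_subgroup])
    fix l h assume lh: "l \<in> L i" "h \<in> H"
    \<comment> \<open>This is [l,h], with \<open>h\<close> written as a double inverse so that
      \<open>L_conj\<close> applies to \<open>inv h\<close>.\<close>
    have "inv l \<otimes> (inv h \<otimes> l \<otimes> inv (inv h)) \<in> L i"
      by (intro subgroup.m_closed[OF L_subgroup] subgroup.m_inv_closed[OF L_subgroup] L_conj
          H.m_inv_closed lh)
    then show "commutator G l h \<in> L i"
      using lh L_carrier[of i] by (auto simp: commutator_def m_assoc subset_eq)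
  qed
  \<comment> \<open>The L_i decrease, so the index is reversed: the chain ascends from
    \<open>H\<close>, which absorbs \<open>L r\<close>, to the group generated by
    \<open>L 0\<close>, which is all of \<open>G\<close>.\<close>
  define K where "K j = generate G (H \<union> L (r - j))" for j
  have carrier: "H \<union> L i \<subseteq> carrier G" for i
    using H.subset L_carrier by simp
  have normal: "generate G (H \<union> L (Suc i)) \<lhd> G\<lparr>carrier := generate G (H \<union> L i)\<rparr>" for i
  proof (rule normal_generate_generate[OF carrier _ carrier])
    show "generate G (H \<union> L (Suc i)) \<subseteq> generate G (H \<union> L i)"
      using L_decr[of i] by (intro mono_generate) auto
    show "inv t \<in> H \<union> L i" if "t \<in> H \<union> L i" for t
      using that subgroup.m_inv_closed[OF L_subgroup] by auto
    fix t s assume t: "t \<in> H \<union> L i" and s: "s \<in> H \<union> L (Suc i)"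
    show "t \<otimes> s \<otimes> inv t \<in> generate G (H \<union> L (Suc i))"
    proof (cases "t \<in> H")
      case True
      then have "t \<otimes> s \<otimes> inv t \<in> H \<union> L (Suc i)"
        using s L_conj by auto
      then show ?thesis by (rule generate.incl)
    next
      case False
      then have t: "t \<in> L i" using t by simp
      show ?thesis
      proof (cases "s \<in> H")
        case True
        \<comment> \<open>Conjugating \<open>s\<close> in \<open>H\<close> by \<open>t\<close>
          changes it only by the factor [t^-1, s]^-1, an element of [L_i, H] = L_(i+1).\<close>
        have "inv t \<in> L i"
          by (rule subgroup.m_inv_closed[OF L_subgroup t])
        then have "inv (commutator G (inv t) s) \<in> L (Suc i)"
          unfolding L_Suc
          using True subgroup.m_inv_closed[OF commutator_subgroup_is_subgroup[OF L_carrier H.subset]]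
            commutator_in_commutator_subgroup
          by blast
        moreover have "t \<otimes> s \<otimes> inv t = s \<otimes> inv (commutator G (inv t) s)"
          using True t L_carrier[of i]
          by (auto simp: commutator_def m_assoc inv_mult_group subset_eq)
        ultimately show ?thesis
          using True by (simp add: generate.eng generate.incl)
      next
        case False
        then have "t \<otimes> s \<otimes> inv t \<in> L (Suc i)"
          using s t H.subset commutator_subgroup_conj_left[OF L_subgroup] by (simp add: L_Suc)
        then show ?thesis by (auto intro: generate.incl)
      qed
    qed
  qed
  have "subnormal_chain G H r K"
    unfolding subnormal_chain_def
  proof (intro conjI allI impI)
    have "H \<union> L r = H" using le by (auto simp: L_def)
    then show "K 0 = H"
      by (simp add: K_def generate_eq_self[OF H])
    have "H \<union> L 0 = carrier G" using H.subset by (auto simp: L_def)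
    then show "K r = carrier G"
      by (simp add: K_def generate_eq_self[OF subgroup_self])
    show "subgroup (K i) G" for i
      unfolding K_def by (rule generate_is_subgroup[OF carrier])
    fix i assume "i < r"
    then have "r - i = Suc (r - Suc i)" by simp
    then show "K i \<lhd> G\<lparr>carrier := K (Suc i)\<rparr>"
      using normal[of "r - Suc i"] by (simp add: K_def)
  qed
  then show ?thesis by blast
qed

text \<open>A shortest chain has length d at most \<open>r\<close> and puts the d-fold commutator
  into \<open>H\<close>; further commutators with \<open>H\<close> stay there because
  \<open>H\<close> is a subgroup. Conversely a chain of length exactly \<open>r\<close> bounds the
  least length.\<close>

lemma subnormal_defect_le_iff:
  assumes H: "subgroup H G"
  shows "subnormal G H \<and> defect G H \<le> r
    \<longleftrightarrow> multi_commutator G (carrier G) (replicate r H) \<subseteq> H"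
proof
  assume L: "subnormal G H \<and> defect G H \<le> r"
  define d where "d = defect G H"
  \<comment> \<open>Subnormality guarantees that the \<open>LEAST\<close> in \<open>defect\<close>
    is attained by an actual chain.\<close>
  obtain K where K: "subnormal_chain G H d K"
    using L LeastI_ex[of "\<lambda>r. \<exists>K. subnormal_chain G H r K"]
    by (auto simp: subnormal_def defect_def d_def)
  have "d \<le> r" using L by (simp add: d_def)
  then show "multi_commutator G (carrier G) (replicate r H) \<subseteq> H"
  proof (induction r rule: dec_induct)
    case base
    then show ?case
      using multi_commutator_subset_of_chain[OF K order_refl] K
      by (simp add: subnormal_chain_def)
  next
    case (step n)
    then show ?case
      unfolding multi_commutator_Suc
      using H by (intro commutator_subgroup_least) (auto intro: commutator_in_subgroup)
  qed
next
  assume "multi_commutator G (carrier G) (replicate r H) \<subseteq> H"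
  then have "\<exists>K. subnormal_chain G H r K"
    by (rule subnormal_chain_of_multi_commutator[OF H])
  then show "subnormal G H \<and> defect G H \<le> r"
    unfolding subnormal_def defect_def by (auto intro: Least_le)
qed

end

section \<open>Central products\<close>

context group
begin

lemma internal_central_product_subgroup:
  assumes "internal_central_product G U V"
  shows "subgroup U G" "subgroup V G"
  using assms by (simp_all add: internal_central_product_def)

lemma internal_central_product_commute:
  assumes "internal_central_product G U V" "u \<in> U" "v \<in> V"
  shows "u \<otimes> v = v \<otimes> u"
proof -
  have "commutator G u v = \<one>"
    using assms commutator_in_commutator_subgroup[of u U v V]
    by (simp add: internal_central_product_def)
  then show ?thesis
    using assms(2,3) internal_central_product_subgroup[OF assms(1)] commutator_eq_one_iff
    by (blast dest: subgroup.mem_carrier)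
qed

lemma internal_central_productI:
  assumes U: "subgroup U G" and V: "subgroup V G" and "carrier G \<subseteq> U <#> V"
    and comm: "\<And>u v. u \<in> U \<Longrightarrow> v \<in> V \<Longrightarrow> u \<otimes> v = v \<otimes> u"
  shows "internal_central_product G U V"
  unfolding internal_central_product_def
proof (intro conjI U V)
  show "carrier G = U <#> V"
    using assms(3) set_mult_closed[OF subgroup.subset[OF U] subgroup.subset[OF V]] by (rule antisym)
  have "commutator_subgroup G U V \<subseteq> {\<one>}"
  proof (rule commutator_subgroup_least[OF triv_subgroup])
    fix u v assume "u \<in> U" "v \<in> V"
    then show "commutator G u v \<in> {\<one>}"
      using comm subgroup.mem_carrier[OF U] subgroup.mem_carrier[OF V]
      by (simp add: commutator_eq_one_iff)
  qed
  then show "commutator_subgroup G U V = {\<one>}"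
    using subgroup.one_closed
        [OF commutator_subgroup_is_subgroup[OF subgroup.subset[OF U] subgroup.subset[OF V]]]
    by blast
qed

text \<open>Transfers statements proved for the first factor, such as its normality, to the
  second.\<close>

lemma internal_central_product_sym:
  assumes "internal_central_product G U V"
  shows "internal_central_product G V U"
proof (rule internal_central_productI)
  show "subgroup V G" "subgroup U G"
    using assms by (auto simp: internal_central_product_def)
  show "v \<otimes> u = u \<otimes> v" if "v \<in> V" "u \<in> U" for u v
    using internal_central_product_commute[OF assms that(2,1)] by simp
  have "carrier G = U <#> V"
    using assms by (simp add: internal_central_product_def)
  then show "carrier G \<subseteq> V <#> U"
    using internal_central_product_commute[OF assms] by (fastforce simp: set_mult_def)
qed

text \<open>In a conjugation by \<open>u \<otimes> v\<close> the part \<open>v\<close> acts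
  trivially on \<open>U\<close>, so only conjugation by an element of \<open>U\<close>
  remains.\<close>

lemma internal_central_product_normal:
  assumes "internal_central_product G U V"
  shows "U \<lhd> G"
proof (rule normal_invI)
  show U: "subgroup U G"
    using assms by (simp add: internal_central_product_def)
  fix x a assume "x \<in> carrier G" and a: "a \<in> U"
  then obtain u v where uv: "u \<in> U" "v \<in> V" "x = u \<otimes> v"
    using assms by (auto simp: internal_central_product_def set_mult_def)
  then have car: "u \<in> carrier G" "v \<in> carrier G" "a \<in> carrier G"
    using internal_central_product_subgroup[OF assms] a by (blast dest: subgroup.mem_carrier)+
  have "x \<otimes> a \<otimes> inv x = u \<otimes> (v \<otimes> a) \<otimes> (inv v \<otimes> inv u)"
    using uv car by (simp add: m_assoc inv_mult_group)
  also have "v \<otimes> a = a \<otimes> v"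
    using internal_central_product_commute[OF assms a uv(2)] by simp
  also have "u \<otimes> (a \<otimes> v) \<otimes> (inv v \<otimes> inv u) = u \<otimes> a \<otimes> inv u"
    using car by (simp add: m_assoc)
  also have "\<dots> \<in> U"
    using U a uv by (simp add: subgroup.m_closed subgroup.m_inv_closed)
  finally show "x \<otimes> a \<otimes> inv x \<in> U" .
qed

text \<open>In general [uv, h] = (v^-1 [u,h] v) [v,h]. Here [u,h] lies in the normal subgroup
  \<open>U\<close>, so \<open>v\<close> commutes with it and the conjugation disappears, for
  arbitrary \<open>h\<close>.\<close>

lemma commutator_mult_central_product:
  assumes P: "internal_central_product G U V" and "u \<in> U" "v \<in> V" "h \<in> carrier G"
  shows "commutator G (u \<otimes> v) h = commutator G u h \<otimes> commutator G v h"
proof -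
  have car: "u \<in> carrier G" "v \<in> carrier G"
    using internal_central_product_subgroup[OF P] assms(2,3) by (blast dest: subgroup.mem_carrier)+
  have "commutator G u h \<in> U"
    using assms internal_central_product_normal by (blast intro: commutator_in_normal)
  then have "v \<otimes> commutator G u h = commutator G u h \<otimes> v"
    using internal_central_product_commute[OF P] assms(3) by simp
  then have "commutator G u h = inv v \<otimes> (commutator G u h \<otimes> v)"
    using car assms(4) by (metis cancel_inv_left(2) commutator_closed)
  then have "commutator G u h \<otimes> commutator G v h
      = inv v \<otimes> (commutator G u h \<otimes> v) \<otimes> commutator G v h"
    by simp
  also have "\<dots> = commutator G (u \<otimes> v) h"
    using car assms(4) by (simp add: commutator_def m_assoc inv_mult_group)
  finally show ?thesis by simp
qed

lemma subgroup_set_mult_central_product: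
  assumes P: "internal_central_product G U V"
    and A: "subgroup A G" "A \<subseteq> U" and B: "subgroup B G" "B \<subseteq> V"
  shows "subgroup (A <#> B) G"
proof (rule subgroupI)
  show "A <#> B \<subseteq> carrier G"
    using A B by (intro set_mult_closed subgroup.subset)
  show "A <#> B \<noteq> {}"
    using A B by (auto simp: set_mult_def dest: subgroup.one_closed)
  have comm: "a \<otimes> b = b \<otimes> a" if "a \<in> A" "b \<in> B" for a b
    using that A B internal_central_product_commute[OF P] by blast
  have car: "a \<in> carrier G" if "a \<in> A \<or> a \<in> B" for a
    using that A B by (auto dest: subgroup.mem_carrier)
  show "inv x \<in> A <#> B" if "x \<in> A <#> B" for x
  proof -
    from that obtain a b where ab: "a \<in> A" "b \<in> B" "x = a \<otimes> b"
      by (auto simp: set_mult_def)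
    have "inv x = inv a \<otimes> inv b"
      using ab comm[of a b] car by (simp add: inv_mult_group)
    then show ?thesis
      using ab A B by (auto simp: set_mult_def intro: subgroup.m_inv_closed)
  qed
  show "x \<otimes> y \<in> A <#> B" if xy: "x \<in> A <#> B" "y \<in> A <#> B" for x y
  proof -
    from xy obtain a b c d
      where ab: "a \<in> A" "b \<in> B" "x = a \<otimes> b" and cd: "c \<in> A" "d \<in> B" "y = c \<otimes> d"
      by (auto simp: set_mult_def)
    have "x \<otimes> y = a \<otimes> (b \<otimes> c) \<otimes> d"
      using ab cd car by (simp add: m_assoc)
    also have "\<dots> = a \<otimes> (c \<otimes> b) \<otimes> d"
      using comm[of c b] ab cd by simp
    also have "\<dots> = (a \<otimes> c) \<otimes> (b \<otimes> d)"
      using ab cd car by (simp add: m_assoc)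
    finally show ?thesis
      using ab cd A B by (auto simp: set_mult_def intro: subgroup.m_closed)
  qed
qed

text \<open>By induction every element of the n-fold commutator splits as a product
  \<open>a \<otimes> b\<close> along the factors, and [ab, h] = [a,h] [b,h] splits the next
  commutator.\<close>

lemma multi_commutator_carrier_subset_set_mult:
  assumes P: "internal_central_product G U V" and H: "H \<subseteq> carrier G"
  shows "multi_commutator G (carrier G) (replicate n H)
    \<subseteq> multi_commutator G U (replicate n H) <#> multi_commutator G V (replicate n H)"
proof (induction n)
  case 0
  then show ?case using P by (simp add: internal_central_product_def)
next
  case (Suc n)
  let ?A = "\<lambda>n. multi_commutator G U (replicate n H)"
  let ?B = "\<lambda>n. multi_commutator G V (replicate n H)"
  \<comment> \<open>Normality of the factors keeps the iterated commutators inside them, so elements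
    of \<open>?A n\<close> and \<open>?B n\<close> commute.\<close>
  have A: "subgroup (?A n) G" "?A n \<subseteq> U" and B: "subgroup (?B n) G" "?B n \<subseteq> V" for n
    using multi_commutator_is_subgroup[OF _ H] multi_commutator_normal_subset[OF _ H]
      internal_central_product_subgroup[OF P] internal_central_product_normal[OF P]
      internal_central_product_normal[OF internal_central_product_sym[OF P]]
    by auto
  have "commutator G x h \<in> ?A (Suc n) <#> ?B (Suc n)"
    if "x \<in> multi_commutator G (carrier G) (replicate n H)" "h \<in> H" for x h
  proof -
    have "x \<in> ?A n <#> ?B n"
      using Suc that by blast
    then obtain a b where ab: "a \<in> ?A n" "b \<in> ?B n" "x = a \<otimes> b"
      by (auto simp: set_mult_def)
    have "commutator G x h = commutator G a h \<otimes> commutator G b h"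
      unfolding ab(3)
      by (rule commutator_mult_central_product[OF P subsetD[OF A(2) ab(1)] subsetD[OF B(2) ab(2)]
            subsetD[OF H that(2)]])
    moreover have "commutator G a h \<in> ?A (Suc n)" "commutator G b h \<in> ?B (Suc n)"
      unfolding multi_commutator_Suc
      by (rule commutator_in_commutator_subgroup[OF ab(1) that(2)]
          commutator_in_commutator_subgroup[OF ab(2) that(2)])+
    ultimately show ?thesis
      unfolding set_mult_def by blast
  qed
  then show ?case
    \<comment> \<open>The product set is itself a subgroup, so containing the generating commutators
      is enough.\<close>
    unfolding multi_commutator_Suc[of G "carrier G"]
    by (rule commutator_subgroup_least[OF subgroup_set_mult_central_product[OF P A B]])
qed

text \<open>Downwards, monotonicity gives containment in \<open>H\<close> and normality of the
  factors gives containment in \<open>U\<close> and \<open>V\<close>. Upwards, \<open>H\<close> is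
  closed under the products that cover the full commutator.\<close>

lemma multi_commutator_central_product_iff:
  assumes P: "internal_central_product G U V" and H: "subgroup H G"
  shows "multi_commutator G (carrier G) (replicate r H) \<subseteq> H
    \<longleftrightarrow> multi_commutator G U (replicate r H) \<subseteq> U \<inter> H
      \<and> multi_commutator G V (replicate r H) \<subseteq> V \<inter> H" (is "?L \<longleftrightarrow> ?R")
proof
  note H_sub = subgroup.subset[OF H]
  assume L: ?L
  have "multi_commutator G W (replicate r H) \<subseteq> W \<inter> H" if "W \<lhd> G" for W
    using multi_commutator_normal_subset[OF that H_sub]
      order_trans[OF multi_commutator_mono[OF subgroup.subset[OF normal_imp_subgroup[OF that]]] L]
    by (rule le_infI)
  then show ?R
    using internal_central_product_normal[OF P]
      internal_central_product_normal[OF internal_central_product_sym[OF P]]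
    by simp
next
  assume ?R
  then have "multi_commutator G U (replicate r H) <#> multi_commutator G V (replicate r H) \<subseteq> H"
    using subgroup.m_closed[OF H] unfolding set_mult_def by blast
  then show ?L
    by (rule order_trans[OF multi_commutator_carrier_subset_set_mult[OF P subgroup.subset[OF H]]])
qed

text \<open>Elements of the two embedded factors commute componentwise, and (u,v) = (u,1)(1,v). This
  lets the criterion for central products be applied to the external direct product.\<close>

lemma DirProd_internal_central_product:
  assumes U: "subgroup U G" and V: "subgroup V G"
  shows "internal_central_product (G\<lparr>carrier := U\<rparr> \<times>\<times> G\<lparr>carrier := V\<rparr>)
    {(u, \<one>) | u. u \<in> U} {(\<one>, v) | v. v \<in> V}"
proof -
  have U_eq: "{(u, \<one>) | u. u \<in> U} = U \<times> {\<one>}" and V_eq: "{(\<one>, v) | v. v \<in> V} = {\<one>} \<times> V"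
    by blast+
  interpret U: subgroup U G by fact
  interpret V: subgroup V G by fact
  interpret GU: group "G\<lparr>carrier := U\<rparr>"
    by (rule U.subgroup_is_group[OF group_axioms])
  interpret GV: group "G\<lparr>carrier := V\<rparr>"
    by (rule V.subgroup_is_group[OF group_axioms])
  interpret D: group "G\<lparr>carrier := U\<rparr> \<times>\<times> G\<lparr>carrier := V\<rparr>"
    by (rule DirProd_group[OF GU.group_axioms GV.group_axioms])
  have sub: "subgroup (U \<times> {\<one>}) (G\<lparr>carrier := U\<rparr> \<times>\<times> G\<lparr>carrier := V\<rparr>)"
    "subgroup ({\<one>} \<times> V) (G\<lparr>carrier := U\<rparr> \<times>\<times> G\<lparr>carrier := V\<rparr>)"
    using DirProd_subgroups[OF GU.group_axioms GU.subgroup_self GV.group_axioms GV.triv_subgroup]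
      DirProd_subgroups[OF GU.group_axioms GU.triv_subgroup GV.group_axioms GV.subgroup_self]
    by simp_all
  show ?thesis
    unfolding U_eq V_eq
    by (rule D.internal_central_productI[OF sub]) (auto simp: set_mult_def)
qed

end

section \<open>Epimorphisms\<close>

context group_hom
begin

lemma hom_commutator:
  "a \<in> carrier G \<Longrightarrow> b \<in> carrier G \<Longrightarrow> h (commutator G a b) = commutator H (h a) (h b)"
  by (simp add: commutator_def)

text \<open>A homomorphism maps the generating commutators onto those of the images, and generation
  commutes with taking images.\<close>

lemma commutator_subgroup_img:
  assumes "A \<subseteq> carrier G" "B \<subseteq> carrier G"
  shows "h ` commutator_subgroup G A B = commutator_subgroup H (h ` A) (h ` B)"
proof -
  have "h ` {commutator G a b | a b. a \<in> A \<and> b \<in> B}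
      = {commutator H a b | a b. a \<in> h ` A \<and> b \<in> h ` B}" (is "?l = ?r")
  proof -
    have hom: "h (commutator G a b) = commutator H (h a) (h b)" if "a \<in> A" "b \<in> B" for a b
      using hom_commutator that assms by blast
    show ?thesis
    proof
      show "?l \<subseteq> ?r" using hom by blast
      show "?r \<subseteq> ?l" using hom by (clarsimp simp: image_iff) metis
    qed
  qed
  then show ?thesis
    using generate_img[OF G.commutator_set_in_carrier[OF assms]]
    by (simp add: commutator_subgroup_def)
qed

lemma multi_commutator_img:
  assumes "subgroup A G" "B \<subseteq> carrier G"
  shows "h ` multi_commutator G A (replicate n B) = multi_commutator H (h ` A) (replicate n (h ` B))"
proof (induction n)
  case (Suc n)
  then show ?case
    unfolding multi_commutator_Suc
    using assms G.multi_commutator_is_subgroup[OF assms, of n]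
    by (simp add: commutator_subgroup_img subgroup.subset)
qed simp

end

theorem theorem5p6:
  fixes G :: "('a, 'b) monoid_scheme"
    and U\<^sub>1 U\<^sub>2 H :: "'a set"
    and D :: "('a \<times> 'a) monoid"
    and V\<^sub>1 V\<^sub>2 E :: "('a \<times> 'a) set"
    and \<epsilon> :: "'a \<times> 'a \<Rightarrow> 'a"
    and r :: nat
  assumes "group G" and "finite (carrier G)"
    and "internal_central_product G U\<^sub>1 U\<^sub>2"
    and D: "D = G\<lparr>carrier := U\<^sub>1\<rparr> \<times>\<times> G\<lparr>carrier := U\<^sub>2\<rparr>"
    and V\<^sub>1: "V\<^sub>1 = {(u, \<one>\<^bsub>G\<^esub>) | u. u \<in> U\<^sub>1}"
    and V\<^sub>2: "V\<^sub>2 = {(\<one>\<^bsub>G\<^esub>, u) | u. u \<in> U\<^sub>2}"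
    and "\<epsilon> \<in> epi D G"
    and "\<epsilon> ` V\<^sub>1 = U\<^sub>1" and "\<epsilon> ` V\<^sub>2 = U\<^sub>2"
    and "subgroup H G"
    and E: "E = {x \<in> carrier D. \<epsilon> x \<in> H}"
    and "r \<ge> 1"
  shows "((subnormal G H \<and> defect G H \<le> r) \<longleftrightarrow> (subnormal D E \<and> defect D E \<le> r))
    \<and> ((subnormal D E \<and> defect D E \<le> r) \<longleftrightarrow>
        (multi_commutator D V\<^sub>1 (replicate r E) \<subseteq> V\<^sub>1 \<inter> E \<and>
         multi_commutator D V\<^sub>2 (replicate r E) \<subseteq> V\<^sub>2 \<inter> E))
    \<and> ((multi_commutator D V\<^sub>1 (replicate r E) \<subseteq> V\<^sub>1 \<inter> E \<and>
         multi_commutator D V\<^sub>2 (replicate r E) \<subseteq> V\<^sub>2 \<inter> E) \<longleftrightarrow>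
        (multi_commutator G U\<^sub>1 (replicate r H) \<subseteq> U\<^sub>1 \<inter> H \<and>
         multi_commutator G U\<^sub>2 (replicate r H) \<subseteq> U\<^sub>2 \<inter> H))"
proof -
  interpret G: group G by fact
  note P = \<open>internal_central_product G U\<^sub>1 U\<^sub>2\<close> and H = \<open>subgroup H G\<close>
  have U: "subgroup U\<^sub>1 G" "subgroup U\<^sub>2 G"
    using G.internal_central_product_subgroup[OF P] by auto
  interpret D: group D
    unfolding D using U by (intro DirProd_group subgroup.subgroup_is_group) auto
  have Q: "internal_central_product D V\<^sub>1 V\<^sub>2"
    unfolding D V\<^sub>1 V\<^sub>2 by (rule G.DirProd_internal_central_product[OF U])
  interpret e: group_hom D G \<epsilon>
    using \<open>\<epsilon> \<in> epi D G\<close> by unfold_locales (simp add: epi_def)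
  have surj: "\<epsilon> ` carrier D = carrier G"
    using \<open>\<epsilon> \<in> epi D G\<close> by (simp add: epi_def)
  have E_subgroup: "subgroup E D"
  proof (rule D.subgroupI)
    have "\<one>\<^bsub>D\<^esub> \<in> E"
      using subgroup.one_closed[OF H] unfolding E by simp
    then show "E \<noteq> {}" by blast
  qed (use H in \<open>simp_all add: E subset_eq subgroup.m_closed subgroup.m_inv_closed\<close>)
  \<comment> \<open>Surjectivity of \<epsilon> makes the image of the full preimage all of
    \<open>H\<close>.\<close>
  have image_E: "\<epsilon> ` E = H"
    using subgroup.subset[OF H] unfolding E surj[symmetric] by blast
  have "\<epsilon> ` multi_commutator D (carrier D) (replicate r E)
      = multi_commutator G (carrier G) (replicate r H)"
    using e.multi_commutator_img[OF D.subgroup_self subgroup.subset[OF E_subgroup]] surj image_E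
    by simp
  moreover have "multi_commutator D (carrier D) (replicate r E) \<subseteq> carrier D"
    by (intro subgroup.subset D.multi_commutator_is_subgroup D.subgroup_self E_subgroup)
  \<comment> \<open>As \<open>E\<close> is a full preimage, containment in \<open>E\<close> can be
    tested after applying \<epsilon>; this links the commutator conditions in \<open>D\<close> and
    \<open>G\<close>.\<close>
  moreover have "M \<subseteq> E \<longleftrightarrow> \<epsilon> ` M \<subseteq> H" if "M \<subseteq> carrier D" for M
    unfolding E using that by blast
  ultimately have "multi_commutator D (carrier D) (replicate r E) \<subseteq> E
      \<longleftrightarrow> multi_commutator G (carrier G) (replicate r H) \<subseteq> H"
    by metis
  \<comment> \<open>Each subnormality condition equals the commutator condition on its whole group,
    which in turn equals the pair of conditions on the two factors; the equivalence just shown joins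
    \<open>D\<close> to \<open>G\<close>.\<close>
  then show ?thesis
    using G.subnormal_defect_le_iff[OF H, of r] D.subnormal_defect_le_iff[OF E_subgroup, of r]
      G.multi_commutator_central_product_iff[OF P H, of r]
      D.multi_commutator_central_product_iff[OF Q E_subgroup, of r]
    by simp
qed

end
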